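(* Let $N$ be an odd perfect number, and let $n, \alpha$ be integers and $q$ a prime such that $N = n^{2}q^{\alpha}$, $q \nmid n$, and $q \equiv \alpha \equiv 1 \bmod 4$. Then the following hold. (1) If $\alpha = 1$, then $\frac{\sigma(n^{2})}{q} > 1$. (2) If $\alpha > 1$, then $\frac{\sigma(n^{2})}{q^{\alpha}}$ is neither a square nor a square times a single prime; that is, there exist no integer $n_{0}$ and no $l$ which is either $1$ or a prime such that $\frac{\sigma(n^{2})}{q^{\alpha}} = l n_{0}^{2}$.
   Context: For a positive integer $m$, $\sigma(m)$ denotes the sum of the positive divisors of $m$. A positive integer $N$ is perfect if $\sigma(N) = 2N$. By a classical theorem of Euler, every odd perfect number $N$ can be written as $N = n^{2}q^{\alpha}$ with $q$ prime, $q \nmid n$ and $q \equiv \alpha \equiv 1 \bmod 4$; in this situation $\frac{\sigma(n^{2})}{q^{\alpha}}$ is an integer. *)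

theory Defs
  imports "HOL-Number_Theory.Number_Theory"
begin

text \<open>Meant for positive arguments; at 0 the index set is infinite and the sum is 0.\<close>
definition divisor_sum :: "int \<Rightarrow> int" where
  "divisor_sum m = (\<Sum>d | 0 < d \<and> d dvd m. d)"

definition perfect :: "int \<Rightarrow> bool" where
  "perfect N \<longleftrightarrow> 0 < N \<and> divisor_sum N = 2 * N"

end

theory Submission
  imports Defs "HOL-Computational_Algebra.Nth_Powers"
begin

text \<open>
  Everything starts from \<open>\<sigma>(n\<^sup>2) \<cdot> \<sigma>(q\<^sup>\<alpha>) = 2 n\<^sup>2 q\<^sup>\<alpha>\<close>, which is multiplicativity of \<open>\<sigma>\<close>.

  If \<open>\<alpha> = 1\<close>, then \<open>\<sigma>(n\<^sup>2) = q m\<close> with \<open>m (q + 1) = 2 n\<^sup>2\<close>. The value \<open>m = 1\<close> would make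
  \<open>\<sigma>(n\<^sup>2) = 2 n\<^sup>2 - 1 = q\<close> prime, so that \<open>n\<^sup>2\<close> would be a power of one prime \<open>r\<close>, and the
  geometric sum for \<open>\<sigma>(r\<^sup>e)\<close> then forces \<open>r = 2\<close>, although \<open>n\<close> is odd.

  If \<open>\<alpha> > 1\<close>, write \<open>\<alpha> + 1 = 2 k\<close>, so that \<open>k \<ge> 3\<close> is odd. Then \<open>\<sigma>(q\<^sup>\<alpha>) = 2 A B\<close> with the coprime
  numbers \<open>A = (q\<^sup>k - 1) / (q - 1)\<close> and \<open>B = (q\<^sup>k + 1) / 2\<close>. If \<open>\<sigma>(n\<^sup>2) / q\<^sup>\<alpha> = l n\<^sub>0\<^sup>2\<close> with \<open>l\<close> equal to
  \<open>1\<close> or prime, then \<open>A B l n\<^sub>0\<^sup>2 = n\<^sup>2\<close>. The prime \<open>l\<close> can disturb only one of \<open>A\<close> and \<open>B\<close>, so the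
  other one is a square. Both possibilities are excluded.

  \<^item> \<open>A = y\<^sup>2\<close> with \<open>k = 2 t + 1\<close> reads \<open>q (q\<^sup>t)\<^sup>2 - (q - 1) y\<^sup>2 = 1\<close>. The positive solutions \<open>(u, v)\<close> of
    \<open>(c + 1) u\<^sup>2 - c v\<^sup>2 = 1\<close> are the coefficients of the odd powers of \<open>\<surd>(c + 1) + \<surd>c\<close>. The binomial
    expansion of the \<open>m\<close>-th power shows that \<open>q\<^sup>t\<close> divides \<open>m\<close> as soon as it divides \<open>u\<close>, whereas
    \<open>u > m\<close> for \<open>m > 1\<close>; hence no solution but the first has a power of \<open>q\<close> as \<open>u\<close>
    (\<open>repunit_not_square\<close>).

  \<^item> \<open>B = y\<^sup>2\<close>: choose a prime \<open>p\<close> dividing \<open>k\<close>, put \<open>Q = q\<^bsup>k/p\<^esup>\<close> and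
    \<open>E\<^sub>m = (Q\<^sup>m + 1) / (Q + 1)\<close> for odd \<open>m\<close>. In \<open>(Q + 1) / 2 \<cdot> E\<^sub>p = y\<^sup>2\<close> the only possible common prime
    divisor is \<open>p\<close>, so \<open>E\<^sub>p\<close> or \<open>p E\<^sub>p\<close> is a square. The first case is again the Pell equation, now with
    \<open>c = Q\<close> (\<open>alt_geom_not_square\<close>). In the second case Jacobi symbols decide: since
    \<open>Q \<equiv> 1 (mod 4)\<close>, Euclid's algorithm on the indices together with quadratic reciprocity gives
    \<open>(E\<^sub>p / E\<^sub>m) = 1\<close> for all odd \<open>m\<close> coprime to \<open>p\<close>. Hence \<open>(p / E\<^sub>m) \<ge> 0\<close>, while reciprocity and
    \<open>E\<^sub>m \<equiv> m (mod p)\<close> give \<open>(p / E\<^sub>m) = (m / p)\<close>. So no odd \<open>m\<close> would be a non-residue modulo \<open>p\<close>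
    (\<open>prime_times_alt_geom_not_square\<close>).
\<close>

section \<open>The Jacobi symbol\<close>

text \<open>
  Both sides are congruent modulo \<open>p\<close> by Euler's criterion, and they differ by at most \<open>2 < p\<close>.
\<close>

lemma Legendre_mult:
  fixes p :: nat
  assumes "prime p" "2 < p"
  shows "Legendre (a * b) p = Legendre a p * Legendre b p"
proof -
  let ?e = "(p - 1) div 2"
  have "[Legendre (a * b) p = (a * b) ^ ?e] (mod p)"
    using assms by (rule euler_criterion)
  moreover have "[Legendre a p * Legendre b p = a ^ ?e * b ^ ?e] (mod p)"
    using assms by (intro cong_mult euler_criterion)
  ultimately have "[Legendre (a * b) p = Legendre a p * Legendre b p] (mod p)"
    by (metis power_mult_distrib cong_sym cong_trans)
  then have dvd: "int p dvd Legendre (a * b) p - Legendre a p * Legendre b p"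
    by (simp add: cong_iff_dvd_diff)
  have "\<bar>Legendre (a * b) p - Legendre a p * Legendre b p\<bar> < int p"
    using \<open>2 < p\<close> by (auto simp: Legendre_def)
  with dvd show ?thesis
    using zdvd_imp_le[of "int p" "\<bar>Legendre (a * b) p - Legendre a p * Legendre b p\<bar>"] by force
qed

lemma Legendre_cong:
  assumes "[a = b] (mod p)"
  shows "Legendre a p = Legendre b p"
  using assms by (simp add: Legendre_def QuadRes_def cong_def)

lemma Legendre_one:
  assumes "1 < p"
  shows "Legendre 1 p = 1"
proof -
  have "QuadRes p 1" unfolding QuadRes_def by (rule exI[of _ 1]) simp
  moreover have "\<not> [1 = 0] (mod p)" using assms by (simp add: cong_iff_dvd_diff zdvd1_eq)
  ultimately show ?thesis by (simp add: Legendre_def)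
qed

definition jacobi :: "int \<Rightarrow> nat \<Rightarrow> int" where
  "jacobi a n = (\<Prod>p\<in>#prime_factorization n. Legendre a (int p))"

lemma jacobi_Suc_0 [simp]: "jacobi a (Suc 0) = 1"
  by (simp add: jacobi_def)

lemma jacobi_prime: "prime p \<Longrightarrow> jacobi a p = Legendre a p"
  by (simp add: jacobi_def prime_factorization_prime)

lemma jacobi_mult_right:
  "m > 0 \<Longrightarrow> n > 0 \<Longrightarrow> jacobi a (m * n) = jacobi a m * jacobi a n"
  by (simp add: jacobi_def prime_factorization_mult)

lemma odd_prime_factor_gt_2:
  assumes "odd n" "p \<in># prime_factorization n"
  shows "prime p" "2 < (p::nat)"
proof -
  show p: "prime p" using assms(2) by auto
  have "p dvd n" using assms(2) by auto
  then have "p \<noteq> 2" using assms(1) by auto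
  then show "2 < p" using prime_ge_2_nat[OF p] by simp
qed

lemma jacobi_mult_left:
  assumes "odd n"
  shows "jacobi (a * b) n = jacobi a n * jacobi b n"
proof -
  have "image_mset (\<lambda>p. Legendre (a * b) (int p)) (prime_factorization n)
      = image_mset (\<lambda>p. Legendre a (int p) * Legendre b (int p)) (prime_factorization n)"
    using odd_prime_factor_gt_2[OF assms] by (intro image_mset_cong) (simp add: Legendre_mult)
  then show ?thesis by (simp add: jacobi_def prod_mset.distrib)
qed

lemma jacobi_cong:
  assumes "[a = b] (mod int n)"
  shows "jacobi a n = jacobi b n"
proof -
  have "image_mset (\<lambda>p. Legendre a (int p)) (prime_factorization n)
      = image_mset (\<lambda>p. Legendre b (int p)) (prime_factorization n)"
  proof (intro image_mset_cong Legendre_cong)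
    fix p assume "p \<in># prime_factorization n"
    then have "int p dvd int n" by auto
    with assms show "[a = b] (mod int p)" using cong_dvd_modulus by blast
  qed
  then show ?thesis by (simp add: jacobi_def)
qed

lemma jacobi_one:
  assumes "odd n"
  shows "jacobi 1 n = 1"
proof -
  have "image_mset (\<lambda>p. Legendre 1 (int p)) (prime_factorization n)
      = image_mset (\<lambda>p. 1) (prime_factorization n)"
  proof (intro image_mset_cong Legendre_one)
    fix p assume "p \<in># prime_factorization n"
    from odd_prime_factor_gt_2(2)[OF assms this] show "1 < int p" by simp
  qed
  then show ?thesis by (simp add: jacobi_def)
qed

lemma jacobi_power_left: "odd n \<Longrightarrow> jacobi (a ^ k) n = jacobi a n ^ k"
  by (induction k) (simp_all add: jacobi_one jacobi_mult_left)

text \<open>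
  The sign \<open>(-1)\<close> to the power \<open>(m - 1)/2 \<cdot> (n - 1)/2\<close> of the reciprocity law, in a form whose
  multiplicativity in each odd argument is immediate.
\<close>

definition reciprocity_sign :: "nat \<Rightarrow> nat \<Rightarrow> int" where
  "reciprocity_sign m n = (if m mod 4 = 3 \<and> n mod 4 = 3 then -1 else 1)"

lemma odd_mod_4: "odd (n::nat) \<Longrightarrow> n mod 4 = 1 \<or> n mod 4 = 3"
  by presburger

lemma odd_if_cong_1_mod_4:
  assumes "[n = 1] (mod 4)"
  shows "odd (n::nat)"
proof -
  have "n mod 4 = 1" using assms by (simp add: cong_def)
  then show ?thesis by presburger
qed

lemma odd_mult_mod_4_eq_3_iff:
  assumes "odd (a::nat)" "odd b"
  shows "(a * b) mod 4 = 3 \<longleftrightarrow> (a mod 4 = 3) \<noteq> (b mod 4 = 3)"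
proof -
  have "(a * b) mod 4 = ((a mod 4) * (b mod 4)) mod 4" by (simp only: mod_mult_eq)
  then show ?thesis using odd_mod_4[OF assms(1)] odd_mod_4[OF assms(2)] by auto
qed

lemma reciprocity_sign_mult_left:
  assumes "odd a" "odd b"
  shows "reciprocity_sign (a * b) n = reciprocity_sign a n * reciprocity_sign b n"
  unfolding reciprocity_sign_def odd_mult_mod_4_eq_3_iff[OF assms] by simp

lemma reciprocity_sign_commute: "reciprocity_sign m n = reciprocity_sign n m"
  by (auto simp: reciprocity_sign_def)

text \<open>
  Gauss's law with the product of the two symbols moved to one side, in which form it also holds
  (trivially) for \<open>p = q\<close> and extends to composite arguments by multiplicativity alone.
\<close>

lemma Legendre_reciprocity_sign:
  fixes p q :: nat
  assumes "prime p" "2 < p" "prime q" "2 < q"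
  shows "Legendre p q = reciprocity_sign p q * Legendre q p"
proof (cases "p = q")
  case True
  then show ?thesis by (simp add: Legendre_def cong_def)
next
  case False
  have odd: "odd p" "odd q" using assms prime_odd_nat by auto
  have sign: "(-1::int) ^ ((p - 1) div 2 * ((q - 1) div 2)) = reciprocity_sign p q"
  proof -
    have par: "even ((n - 1) div 2) \<longleftrightarrow> n mod 4 \<noteq> 3" if "odd n" for n :: nat
      using that by presburger
    show ?thesis
      unfolding reciprocity_sign_def minus_one_power_iff even_mult_iff
        par[OF odd(1)] par[OF odd(2)]
      by simp
  qed
  have prod: "Legendre p q * Legendre q p = reciprocity_sign p q"
    using Quadratic_Reciprocity[OF assms False] sign by simp
  moreover have "Legendre q p * Legendre q p = 1"
  proof -
    have "Legendre q p \<noteq> 0" using prod by (auto simp: reciprocity_sign_def split: if_splits)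
    then show ?thesis by (auto simp: Legendre_def split: if_splits)
  qed
  ultimately show ?thesis by (metis mult.assoc mult.right_neutral)
qed

lemma jacobi_Legendre_reciprocity:
  fixes p :: nat
  assumes "prime p" "2 < p" "odd m"
  shows "Legendre m p = reciprocity_sign m p * jacobi p m"
  using assms(3)
proof (induction m rule: prime_divisors_induct)
  case zero
  then show ?case by simp
next
  case (unit x)
  then show ?case using assms by (simp add: Legendre_one reciprocity_sign_def)
next
  case (factor r x)
  then have "r \<noteq> 2" "odd x" "odd r" "0 < x" by (auto simp: odd_pos)
  with factor have "2 < r" using prime_ge_2_nat[of r] by simp
  show ?case
    using factor.IH[OF \<open>odd x\<close>] Legendre_reciprocity_sign[OF factor.hyps \<open>2 < r\<close> assms(1,2)]
      \<open>0 < x\<close> prime_gt_0_nat[OF factor.hyps]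
    by (simp add: Legendre_mult[OF assms(1,2)] jacobi_mult_right jacobi_prime[OF factor.hyps]
        reciprocity_sign_mult_left[OF \<open>odd r\<close> \<open>odd x\<close>])
qed

text \<open>
  Both sides are multiplicative in \<open>m\<close> and in \<open>n\<close>, so the law for primes lifts to \<open>m\<close> (previous
  lemma) and then to \<open>n\<close> by induction on the prime factors. For arguments with a common factor both
  sides vanish.
\<close>

theorem jacobi_reciprocity:
  assumes "odd m" "odd n"
  shows "jacobi m n = reciprocity_sign m n * jacobi n m"
  using assms(2)
proof (induction n rule: prime_divisors_induct)
  case zero
  then show ?case by simp
next
  case (unit x)
  then show ?case using assms by (simp add: jacobi_one reciprocity_sign_def)
next
  case (factor r x)
  then have "r \<noteq> 2" "odd x" "odd r" "0 < x" by (auto simp: odd_pos)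
  with factor have "2 < r" using prime_ge_2_nat[of r] by simp
  show ?case
    using factor.IH[OF \<open>odd x\<close>] jacobi_Legendre_reciprocity[OF factor.hyps \<open>2 < r\<close> assms(1)]
      \<open>0 < x\<close> prime_gt_0_nat[OF factor.hyps]
    by (simp add: jacobi_mult_left[OF assms(1)] jacobi_mult_right jacobi_prime[OF factor.hyps]
        reciprocity_sign_mult_left[OF \<open>odd r\<close> \<open>odd x\<close>] reciprocity_sign_commute[of m])
qed

corollary jacobi_swap:
  assumes "odd m" "[n = 1] (mod 4)"
  shows "jacobi m n = jacobi n m"
proof -
  have "reciprocity_sign m n = 1" using assms(2) by (simp add: reciprocity_sign_def cong_def)
  then show ?thesis
    using jacobi_reciprocity[OF assms(1) odd_if_cong_1_mod_4[OF assms(2)]] by simp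
qed

text \<open>
  Squaring is not injective on the residues modulo \<open>p\<close>, as \<open>1\<close> and \<open>-1\<close> have the same square, hence
  not surjective.
\<close>

lemma exists_odd_nonresidue:
  fixes p :: nat
  assumes "prime p" "2 < p"
  shows "\<exists>n>0. odd n \<and> Legendre (int n) p = -1"
proof -
  let ?f = "\<lambda>y. y\<^sup>2 mod int p" and ?I = "{0..<int p}"
  have img: "?f ` ?I \<subseteq> ?I"
    using prime_gt_0_nat[OF assms(1)] by (intro image_subsetI) simp
  have "\<not> inj_on ?f ?I"
  proof
    have "(int p - 1)\<^sup>2 mod int p = 1\<^sup>2 mod int p"
    proof -
      have "(int p - 1)\<^sup>2 - 1\<^sup>2 = int p * (int p - 2)"
        by (simp add: power2_eq_square algebra_simps)
      then show ?thesis by (metis dvd_triv_left mod_eq_dvd_iff)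
    qed
    moreover assume "inj_on ?f ?I"
    moreover have "int p - 1 \<in> ?I" "1 \<in> ?I" using assms by auto
    ultimately have "int p - 1 = 1" by (auto dest: inj_onD[of ?f ?I "int p - 1" 1])
    then show False using assms by simp
  qed
  then have "?f ` ?I \<noteq> ?I" using finite_surj_inj[of ?I ?f] by auto
  with img obtain a where a: "a \<in> ?I" "a \<notin> ?f ` ?I" by blast
  have "\<not> QuadRes p a"
  proof
    assume "QuadRes p a"
    then obtain y where "y\<^sup>2 mod int p = a mod int p" by (auto simp: QuadRes_def cong_def)
    then have "a = ?f (y mod int p)" using a(1) by (simp add: power_mod)
    moreover have "y mod int p \<in> ?I" using assms by simp
    ultimately show False using a(2) by blast
  qed
  moreover have "\<not> [a = 0] (mod int p)"
  proof
    assume "[a = 0] (mod int p)"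
    then have "a = ?f 0" using a(1) by (simp add: cong_def)
    moreover have "0 \<in> ?I" using assms by simp
    ultimately show False using a(2) by blast
  qed
  ultimately have Leg: "Legendre a p = -1" by (simp add: Legendre_def)
  have "a \<noteq> 0" using \<open>\<not> [a = 0] (mod int p)\<close> by auto
  \<comment> \<open>Since \<open>p\<close> is odd, one of \<open>a\<close> and \<open>a + p\<close> is an odd representative.\<close>
  define n where "n = (if odd a then nat a else nat (a + p))"
  have "odd p" using assms prime_odd_nat by auto
  then have "odd n" "n > 0" using a(1) \<open>a \<noteq> 0\<close>
    by (auto simp: n_def even_nat_iff)
  moreover have "Legendre (int n) p = Legendre a p"
    using a(1) by (intro Legendre_cong) (auto simp: n_def cong_def)
  ultimately show ?thesis using Leg by auto
qed

section \<open>Alternating geometric sums and their Jacobi symbols\<close>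

text \<open>
  For odd \<open>n\<close> this is \<open>(Q\<^sup>n + 1) / (Q + 1)\<close>, the integer written \<open>E\<^sub>n\<close> above.
\<close>

definition alt_geom :: "nat \<Rightarrow> nat \<Rightarrow> int" where
  "alt_geom Q n = (\<Sum>i<n. (- int Q) ^ i)"

lemma alt_geom_0 [simp]: "alt_geom Q 0 = 0"
  by (simp add: alt_geom_def)

lemma alt_geom_1 [simp]: "alt_geom Q (Suc 0) = 1"
  by (simp add: alt_geom_def)

lemma alt_geom_closed: "(int Q + 1) * alt_geom Q n = 1 - (- int Q) ^ n"
  using one_diff_power_eq[of "- int Q" n] by (simp add: alt_geom_def add.commute)

lemma alt_geom_closed_odd: "odd n \<Longrightarrow> (int Q + 1) * alt_geom Q n = int Q ^ n + 1"
  by (simp add: alt_geom_closed)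

text \<open>
  This is what makes Euclid's algorithm run on the indices: modulo \<open>alt_geom Q n\<close>, an index may be
  shifted by multiples of \<open>n\<close>, and reflected at the cost of a power of the base.
\<close>

lemma alt_geom_add: "alt_geom Q (m + n) = alt_geom Q m + (- int Q) ^ m * alt_geom Q n"
  by (induction n) (simp_all add: alt_geom_def algebra_simps power_add)

lemma alt_geom_dvd_mult: "alt_geom Q n dvd alt_geom Q (n * k)"
  by (induction k) (simp_all add: alt_geom_add)

lemma alt_geom_pos:
  assumes "odd n"
  shows "alt_geom Q n > 0"
proof -
  have "(int Q + 1) * alt_geom Q n > 0"
    unfolding alt_geom_closed_odd[OF assms] by (simp add: add_nonneg_pos)
  then show ?thesis by (simp add: zero_less_mult_iff)
qed

lemma alt_geom_mod_base: "odd n \<Longrightarrow> [alt_geom Q n = 1] (mod int Q)"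
  by (cases n) (auto simp: alt_geom_def cong_iff_dvd_diff sum.lessThan_Suc_shift
      simp del: sum.lessThan_Suc intro!: dvd_sum)

lemma alt_geom_mod_4:
  assumes "odd n" "[Q = 1] (mod 4)"
  shows "[alt_geom Q n = 1] (mod 4)"
proof -
  have "[alt_geom Q n = (\<Sum>i<n. (-1) ^ i)] (mod 4)"
    unfolding alt_geom_def
  proof (intro cong_sum cong_pow)
    have "[int Q = 1] (mod 4)" using assms(2) cong_int_iff[of Q 1 4] by simp
    then show "[- int Q = - 1] (mod 4)" by (simp only: cong_minus_minus_iff)
  qed
  also have "(\<Sum>i<n. (-1::int) ^ i) = 1"
    using one_diff_power_eq[of "-1::int" n] assms(1) by simp
  finally show ?thesis .
qed

text \<open>
  Euclid's algorithm with remainders of least absolute value modulo \<open>2 n\<close> keeps the indices odd: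
  \<open>m \<equiv> \<plusminus>s (mod 2 n)\<close> with \<open>s < n\<close> odd. Passing from \<open>m\<close> to \<open>s\<close> multiplies the term by a power of
  \<open>Q\<close> at most, which does not change the symbol, and reciprocity without sign (all terms with odd
  index are \<open>1\<close> modulo \<open>4\<close>) exchanges \<open>s\<close> and \<open>n\<close>.
\<close>

lemma jacobi_alt_geom:
  assumes Q: "[Q = 1] (mod 4)"
  shows "odd m \<Longrightarrow> odd n \<Longrightarrow> coprime m n \<Longrightarrow>
    jacobi (alt_geom Q m) (nat (alt_geom Q n)) = 1"
proof (induction n arbitrary: m rule: less_induct)
  case (less n)
  let ?E = "alt_geom Q"
  have nat_E: "int (nat (?E k)) = ?E k" if "odd k" for k
    using alt_geom_pos[OF that, of Q] by simp
  have E_mod_4: "[nat (?E k) = 1] (mod 4)" if "odd k" for k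
    using alt_geom_mod_4[OF that Q] nat_E[OF that] cong_int_iff[of "nat (?E k)" 1 4] by simp
  have odd_E: "odd (nat (?E k))" if "odd k" for k
    by (rule odd_if_cong_1_mod_4[OF E_mod_4[OF that]])
  show ?case
  proof (cases "n = 1")
    case True
    then show ?thesis by simp
  next
    case False
    have "odd Q" by (rule odd_if_cong_1_mod_4[OF Q])
    \<comment> \<open>Reciprocity replaces this symbol by one modulo \<open>Q\<close>, where \<open>alt_geom Q n\<close> is \<open>1\<close>.\<close>
    have jac_Q: "jacobi (int Q) (nat (?E n)) = 1"
    proof -
      have "jacobi (int Q) (nat (?E n)) = jacobi (int (nat (?E n))) Q"
        by (rule jacobi_swap[OF \<open>odd Q\<close> E_mod_4[OF \<open>odd n\<close>]])
      also have "\<dots> = jacobi 1 Q"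
        using alt_geom_mod_base[OF \<open>odd n\<close>] nat_E[OF \<open>odd n\<close>] by (intro jacobi_cong) simp
      finally show ?thesis using jacobi_one[OF \<open>odd Q\<close>] by simp
    qed
    define r where "r = m mod (2 * n)"
    define j where "j = m div (2 * n)"
    have m_eq: "m = 2 * n * j + r" by (simp add: r_def j_def)
    then have "odd r" using \<open>odd m\<close> by simp
    have "r < 2 * n" using odd_pos[OF \<open>odd n\<close>] by (simp add: r_def)
    have "r \<noteq> n"
    proof
      assume "r = n"
      then have "m = n * (2 * j + 1)" using m_eq by (simp add: algebra_simps)
      then have "n dvd m" by simp
      with \<open>coprime m n\<close> have "n = 1" by (metis coprime_common_divisor_nat dvd_refl)
      with False show False by simp
    qed
    have "\<exists>s. odd s \<and> s < n \<and> coprime n s \<and>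
      jacobi (?E m) (nat (?E n)) = jacobi (?E s) (nat (?E n))"
    proof (cases "r < n")
      case True
      have "[?E m = ?E r] (mod ?E n)"
      proof -
        have "?E m = ?E r + (- int Q) ^ r * ?E (n * (2 * j))"
          using alt_geom_add[of Q r "n * (2 * j)"] m_eq by (simp add: ac_simps)
        then show ?thesis by (simp add: cong_iff_dvd_diff alt_geom_dvd_mult)
      qed
      moreover have "coprime n r"
      proof (rule coprimeI)
        fix d assume "d dvd n" "d dvd r"
        then have "d dvd m" using m_eq by simp
        then show "is_unit d" using \<open>coprime m n\<close> \<open>d dvd n\<close> coprime_common_divisor by blast
      qed
      ultimately show ?thesis
        using True \<open>odd r\<close> nat_E[OF \<open>odd n\<close>] by (intro exI[of _ r]) (simp add: jacobi_cong)
    next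
      case False
      define s where "s = 2 * n - r"
      have s: "s < n" "odd s" "m + s = n * (2 * (j + 1))"
        using False \<open>r \<noteq> n\<close> \<open>r < 2 * n\<close> \<open>odd r\<close> m_eq by (auto simp: s_def algebra_simps)
      have "[?E m = int Q ^ m * ?E s] (mod ?E n)"
      proof -
        have "?E m - int Q ^ m * ?E s = ?E (n * (2 * (j + 1)))"
          using alt_geom_add[of Q m s] \<open>odd m\<close> unfolding s(3) by simp
        then show ?thesis by (simp only: cong_iff_dvd_diff alt_geom_dvd_mult)
      qed
      then have "jacobi (?E m) (nat (?E n)) = jacobi (int Q ^ m * ?E s) (nat (?E n))"
        using nat_E[OF \<open>odd n\<close>] by (intro jacobi_cong) simp
      also have "\<dots> = jacobi (?E s) (nat (?E n))"
        using odd_E[OF \<open>odd n\<close>] jac_Q by (simp add: jacobi_mult_left jacobi_power_left)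
      finally have "jacobi (?E m) (nat (?E n)) = jacobi (?E s) (nat (?E n))" .
      moreover have "coprime n s"
      proof (rule coprimeI)
        fix d assume "d dvd n" "d dvd s"
        then have "d dvd m + s" "d dvd s" using s(3) by auto
        then have "d dvd m" by (simp add: dvd_add_left_iff)
        then show "is_unit d" using \<open>coprime m n\<close> \<open>d dvd n\<close> coprime_common_divisor by blast
      qed
      ultimately show ?thesis using s by blast
    qed
    then obtain s where s: "odd s" "s < n" "coprime n s"
      and red: "jacobi (?E m) (nat (?E n)) = jacobi (?E s) (nat (?E n))" by blast
    have "jacobi (?E s) (nat (?E n)) = jacobi (?E n) (nat (?E s))"
      using jacobi_swap[OF odd_E[OF \<open>odd s\<close>] E_mod_4[OF \<open>odd n\<close>]] nat_E s(1) \<open>odd n\<close> by simp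
    also have "\<dots> = 1" by (rule less.IH[OF s(2) \<open>odd n\<close> s(1) s(3)])
    finally show ?thesis using red by simp
  qed
qed

text \<open>
  If \<open>p \<cdot> E\<^sub>p\<close> were a square, then \<open>p\<close> would divide \<open>Q + 1\<close>, so that \<open>E\<^sub>n \<equiv> n (mod p)\<close>, and for an odd
  non-residue \<open>n\<close> modulo \<open>p\<close> the chain
  \<open>(n / p) = (E\<^sub>n / p) = (p / E\<^sub>n) = (p E\<^sub>p / E\<^sub>n) \<ge> 0\<close> would be a contradiction.
\<close>

lemma prime_times_alt_geom_not_square:
  assumes Q: "[Q = 1] (mod 4)" and p: "prime p" "2 < p"
  shows "int p * alt_geom Q p \<noteq> z\<^sup>2"
proof
  assume sq: "int p * alt_geom Q p = z\<^sup>2"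
  let ?E = "alt_geom Q"
  have "odd p" using p prime_odd_nat by auto
  have pQ: "int p dvd int Q + 1"
  proof -
    have "int p dvd z\<^sup>2" using sq by (metis dvd_triv_left)
    then have "int p dvd z" using p(1) by (simp add: prime_dvd_power_iff)
    then have "int p * int p dvd int p * ?E p"
      unfolding sq by (simp add: power2_eq_square mult_dvd_mono)
    then have "int p dvd ?E p" using p by simp
    then have "int p dvd int Q ^ p + 1"
      using alt_geom_closed_odd[OF \<open>odd p\<close>, of Q] by (metis dvd_mult)
    then have "p dvd Q ^ p + 1" by (metis int_dvd_int_iff of_nat_1 of_nat_add of_nat_power)
    moreover have "[Q ^ p = Q] (mod p)"
    proof (cases "p dvd Q")
      case True
      then have "p dvd Q ^ p" using dvd_power dvd_trans prime_gt_0_nat[OF p(1)] by blast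
      with True show ?thesis by (simp add: cong_def mod_eq_0_iff_dvd dvd_imp_mod_0)
    next
      case False
      from fermat_theorem[OF p(1) this] have "[Q ^ (p - 1) * Q = 1 * Q] (mod p)"
        by (rule cong_mult) simp
      moreover have "Q ^ (p - 1) * Q = Q ^ p"
        using p by (metis Suc_diff_1 mult.commute power_Suc prime_gt_0_nat)
      ultimately show ?thesis by simp
    qed
    ultimately have "p dvd Q + 1"
      using cong_add_rcancel_nat cong_dvd_iff by metis
    then show ?thesis by (metis int_dvd_int_iff of_nat_1 of_nat_add)
  qed
  have E_mod_p: "[?E n = int n] (mod int p)" for n
  proof -
    have "[- int Q = 1] (mod int p)"
      using pQ by (simp add: cong_iff_dvd_diff dvd_diff_commute)
        (metis add.commute dvd_minus_iff minus_add_distrib uminus_add_conv_diff)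
    then have "[?E n = (\<Sum>i<n. 1 ^ i)] (mod int p)"
      unfolding alt_geom_def by (intro cong_sum cong_pow)
    then show ?thesis by simp
  qed
  obtain n where n: "n > 0" "odd n" "Legendre (int n) p = -1"
    using exists_odd_nonresidue[OF p] by blast
  have "coprime p n"
  proof -
    have "\<not> [int n = 0] (mod int p)" using n(3) by (auto simp: Legendre_def)
    then have "\<not> p dvd n" by (simp add: cong_0_iff)
    then show ?thesis using p(1) by (simp add: prime_imp_coprime)
  qed
  have nat_E: "int (nat (?E n)) = ?E n" using alt_geom_pos[OF n(2), of Q] by simp
  have E_mod_4: "[nat (?E n) = 1] (mod 4)"
    using alt_geom_mod_4[OF n(2) Q] nat_E cong_int_iff[of "nat (?E n)" 1 4] by simp
  then have odd_E: "odd (nat (?E n))" by (rule odd_if_cong_1_mod_4)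
  have "Legendre (int n) p = jacobi (?E n) p"
    unfolding jacobi_prime[OF p(1)] by (rule Legendre_cong[OF cong_sym[OF E_mod_p]])
  also have "\<dots> = jacobi (int p) (nat (?E n))"
    using jacobi_swap[OF \<open>odd p\<close> E_mod_4] nat_E by simp
  also have "\<dots> = jacobi (int p * ?E p) (nat (?E n))"
    using jacobi_alt_geom[OF Q \<open>odd p\<close> n(2) \<open>coprime p n\<close>] by (simp add: jacobi_mult_left[OF odd_E])
  also have "\<dots> = (jacobi z (nat (?E n)))\<^sup>2"
    by (simp add: sq jacobi_power_left[OF odd_E])
  finally have "Legendre (int n) p \<ge> 0" by simp
  with n(3) show False by simp
qed

section \<open>Prime powers in the solutions of a Pell-type equation\<close>

text \<open>
  Fermat descent: dividing \<open>u \<surd>(c + 1) + v \<surd>c\<close> by \<open>(\<surd>(c + 1) + \<surd>c)\<^sup>2 = 2 c + 1 + 2 \<surd>(c (c + 1))\<close> gives a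
  solution \<open>(u', v')\<close> that is smaller and, unless \<open>u = 1\<close>, still positive. The conjugate equation is
  carried along so that both coefficients can be read off by adding and subtracting.
\<close>

lemma pell_consecutive_generated:
  fixes c u v :: int
  assumes "1 \<le> c" "0 < u" "0 < v" "(c + 1) * u\<^sup>2 - c * v\<^sup>2 = 1"
  shows "\<exists>h. sqrt (c + 1) * u + sqrt c * v = (sqrt (c + 1) + sqrt c) ^ (2 * h + 1)
           \<and> sqrt (c + 1) * u - sqrt c * v = (sqrt (c + 1) - sqrt c) ^ (2 * h + 1)"
  using assms(2-4)
proof (induction "nat u" arbitrary: u v rule: less_induct)
  case less
  have eq: "c * (v\<^sup>2 - u\<^sup>2) = u\<^sup>2 - 1" using less.prems(3) by (simp add: algebra_simps)
  show ?case
  proof (cases "u = 1")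
    case True
    with less.prems eq assms(1) have "v\<^sup>2 = 1" by simp
    with less.prems(2) have "v = 1" by (simp add: power2_eq_1_iff)
    with True show ?thesis by (intro exI[of _ 0]) simp
  next
    case False
    define u' where "u' = (2 * c + 1) * u - 2 * c * v"
    define v' where "v' = (2 * c + 1) * v - 2 * (c + 1) * u"
    have u_eq: "u = (2 * c + 1) * u' + 2 * c * v'" and v_eq: "v = (2 * c + 1) * v' + 2 * (c + 1) * u'"
      by (simp_all add: u'_def v'_def algebra_simps)
    have norm': "(c + 1) * u'\<^sup>2 - c * v'\<^sup>2 = 1"
      using less.prems(3) by (simp add: u'_def v'_def power2_eq_square algebra_simps)
    have "1 < u" using False less.prems(1) by simp
    have "u < v"
    proof -
      have "1 < u\<^sup>2" using \<open>1 < u\<close> by (intro one_less_power) auto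
      then have "0 < c * (v\<^sup>2 - u\<^sup>2)" unfolding eq by simp
      then have "u\<^sup>2 < v\<^sup>2" using assms(1) by (simp add: zero_less_mult_iff)
      then show ?thesis by (rule power_less_imp_less_base) (use less.prems(2) in simp)
    qed
    have "0 < u'"
    proof -
      have "(2 * c * v)\<^sup>2 < ((2 * c + 1) * u)\<^sup>2"
      proof -
        have "((2 * c + 1) * u)\<^sup>2 - (2 * c * v)\<^sup>2 = u\<^sup>2 + 4 * c * ((c + 1) * u\<^sup>2 - c * v\<^sup>2)"
          by (simp add: power2_eq_square algebra_simps)
        also have "\<dots> > 0" unfolding less.prems(3) using assms(1) by (simp add: add_nonneg_pos)
        finally show ?thesis by simp
      qed
      then have "2 * c * v < (2 * c + 1) * u"
        by (rule power_less_imp_less_base) (use assms(1) less.prems(1) in simp)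
      then show ?thesis by (simp add: u'_def)
    qed
    \<comment> \<open>The claim is \<open>4 (c + 1) < v\<^sup>2\<close> in disguise, which needs that the second solution is already large.\<close>
    have "0 < v'"
    proof -
      have "2 * c < u"
      proof (rule ccontr)
        assume "\<not> 2 * c < u"
        then have "u * u \<le> 2 * c * u" using \<open>1 < u\<close> by (intro mult_right_mono) auto
        moreover have "c * (2 * u + 1) \<le> c * (v\<^sup>2 - u\<^sup>2)"
        proof (intro mult_left_mono)
          have "(u + 1)\<^sup>2 \<le> v\<^sup>2" using \<open>u < v\<close> \<open>1 < u\<close> by (intro power_mono) auto
          then show "2 * u + 1 \<le> v\<^sup>2 - u\<^sup>2" by (simp add: power2_eq_square algebra_simps)
        qed (use assms in simp)
        ultimately have "c * (2 * u + 1) \<le> 2 * c * u - 1"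
          unfolding eq by (simp add: power2_eq_square)
        then show False using assms(1) by (simp add: algebra_simps)
      qed
      then have "2 * (c + 1) \<le> v" using \<open>u < v\<close> by simp
      then have "(2 * (c + 1))\<^sup>2 \<le> v\<^sup>2" using assms(1) by (intro power_mono) auto
      moreover have "4 * (c + 1) < (2 * (c + 1))\<^sup>2"
        using assms(1) by (simp add: power2_eq_square algebra_simps add_pos_pos)
      moreover have "((2 * c + 1) * v)\<^sup>2 - (2 * (c + 1) * u)\<^sup>2
          = v\<^sup>2 - 4 * (c + 1) * ((c + 1) * u\<^sup>2 - c * v\<^sup>2)"
        by (simp add: power2_eq_square algebra_simps)
      ultimately have "(2 * (c + 1) * u)\<^sup>2 < ((2 * c + 1) * v)\<^sup>2"
        unfolding less.prems(3) by simp
      then have "2 * (c + 1) * u < (2 * c + 1) * v"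
        by (rule power_less_imp_less_base) (use assms(1) less.prems(2) in simp)
      then show ?thesis by (simp add: v'_def)
    qed
    have "u' < u"
    proof -
      have "c * u < c * v" using \<open>u < v\<close> assms(1) by simp
      then show ?thesis by (simp add: u'_def algebra_simps)
    qed
    then have "nat u' < nat u" using \<open>0 < u'\<close> by simp
    from less.hyps[OF this \<open>0 < u'\<close> \<open>0 < v'\<close> norm'] obtain h where
      h: "sqrt (c + 1) * u' + sqrt c * v' = (sqrt (c + 1) + sqrt c) ^ (2 * h + 1)"
         "sqrt (c + 1) * u' - sqrt c * v' = (sqrt (c + 1) - sqrt c) ^ (2 * h + 1)" by blast
    define a where "a = sqrt (c + 1)"
    define b where "b = sqrt c"
    have ab: "a * a = c + 1" "b * b = c" using assms(1) by (simp_all add: a_def b_def)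
    have step: "(a * u' + s * b * v') * (a + s * b)\<^sup>2 = a * u + s * b * v" if "s * s = 1" for s :: real
    proof -
      have sq: "(a + s * b)\<^sup>2 = 2 * c + 1 + 2 * s * a * b"
        using ab that by (simp add: power2_eq_square algebra_simps) algebra
      have "(a * u' + s * b * v') * (2 * c + 1 + 2 * s * a * b)
          = a * ((2 * c + 1) * u') + s * b * ((2 * c + 1) * v')
            + 2 * s * (a * a) * b * u' + 2 * (s * s) * (b * b) * a * v'"
        by (simp add: algebra_simps)
      also have "\<dots> = a * ((2 * c + 1) * u' + 2 * c * v') + s * b * ((2 * c + 1) * v' + 2 * (c + 1) * u')"
        unfolding ab that by (simp add: algebra_simps)
      also have "\<dots> = a * u + s * b * v"
        by (simp only: u_eq[symmetric] v_eq[symmetric])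
      finally show ?thesis unfolding sq .
    qed
    have pow: "x ^ (2 * Suc h + 1) = x ^ (2 * h + 1) * x\<^sup>2" for x :: real
      by (simp add: power2_eq_square)
    have "a * u + b * v = (a + b) ^ (2 * Suc h + 1)"
      unfolding pow h(1)[folded a_def b_def, symmetric] using step[of 1] by simp
    moreover have "a * u - b * v = (a - b) ^ (2 * Suc h + 1)"
      unfolding pow h(2)[folded a_def b_def, symmetric] using step[of "-1"] by simp
    ultimately show ?thesis unfolding a_def b_def by blast
  qed
qed

text \<open>
  The coefficient of \<open>\<surd>R\<close> in \<open>(\<surd>R + \<surd>S)\<^bsup>2h+1\<^esup>\<close>; by symmetry, the coefficient of \<open>\<surd>S\<close> is obtained by
  exchanging \<open>R\<close> and \<open>S\<close>.
\<close>

definition odd_binomial_sum :: "int \<Rightarrow> int \<Rightarrow> nat \<Rightarrow> int" where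
  "odd_binomial_sum R S h = (\<Sum>i\<le>h. int ((2 * h + 1) choose (2 * i + 1)) * R ^ i * S ^ (h - i))"

lemma odd_binomial_sum_eq:
  fixes a b :: real
  assumes "a\<^sup>2 = of_int R" "b\<^sup>2 = of_int S"
  shows "(a + b) ^ (2 * h + 1) + (a - b) ^ (2 * h + 1) = 2 * a * of_int (odd_binomial_sum R S h)"
proof -
  let ?n = "Suc (2 * h)"
  have "(a + b) ^ ?n + (a - b) ^ ?n
      = (\<Sum>k\<le>?n. of_nat (?n choose k) * a ^ k * (b ^ (?n - k) + (- b) ^ (?n - k)))"
    using binomial_ring[of a b ?n] binomial_ring[of a "- b" ?n]
    by (simp only: sum.distrib[symmetric] distrib_left add_uminus_conv_diff)
  also have "\<dots> = (\<Sum>i\<le>h. of_nat (?n choose Suc (2 * i)) * a ^ Suc (2 * i) * (2 * b ^ (2 * (h - i))))"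
    unfolding sum.in_pairs_0
  proof (intro sum.cong refl)
    fix i assume "i \<in> {..h}"
    then have "?n - 2 * i = Suc (2 * (h - i))" "?n - Suc (2 * i) = 2 * (h - i)" by auto
    then show "of_nat (?n choose (2 * i)) * a ^ (2 * i) * (b ^ (?n - 2 * i) + (- b) ^ (?n - 2 * i))
        + of_nat (?n choose Suc (2 * i)) * a ^ Suc (2 * i)
            * (b ^ (?n - Suc (2 * i)) + (- b) ^ (?n - Suc (2 * i)))
        = of_nat (?n choose Suc (2 * i)) * a ^ Suc (2 * i) * (2 * b ^ (2 * (h - i)))"
      by simp
  qed
  also have "\<dots> = 2 * a * of_int (odd_binomial_sum R S h)"
    unfolding odd_binomial_sum_def of_int_sum sum_distrib_left
  proof (intro sum.cong refl)
    fix i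
    have "a ^ (2 * i) = of_int R ^ i" "b ^ (2 * (h - i)) = of_int S ^ (h - i)"
      by (simp_all only: power_mult assms)
    then show "of_nat (?n choose Suc (2 * i)) * a ^ Suc (2 * i) * (2 * b ^ (2 * (h - i)))
        = 2 * a * of_int (int ((2 * h + 1) choose (2 * i + 1)) * R ^ i * S ^ (h - i))"
      by (simp only: of_int_mult of_int_power of_int_of_nat_eq power_add power_one_right Suc_eq_plus1 mult_ac)
  qed
  finally show ?thesis by simp
qed

lemma pell_consecutive_solutions:
  fixes c u v :: int
  assumes "1 \<le> c" "0 < u" "0 < v" "(c + 1) * u\<^sup>2 - c * v\<^sup>2 = 1"
  shows "\<exists>h. u = odd_binomial_sum (c + 1) c h \<and> v = odd_binomial_sum c (c + 1) h"
proof -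
  define a where "a = sqrt (c + 1)"
  define b where "b = sqrt c"
  have ab: "a\<^sup>2 = of_int (c + 1)" "b\<^sup>2 = of_int c" "a > 0" "b > 0"
    using assms(1) by (simp_all add: a_def b_def)
  obtain h where h: "a * u + b * v = (a + b) ^ (2 * h + 1)" "a * u - b * v = (a - b) ^ (2 * h + 1)"
    using pell_consecutive_generated[OF assms] by (auto simp: a_def b_def)
  have "2 * a * u = 2 * a * odd_binomial_sum (c + 1) c h"
    unfolding odd_binomial_sum_eq[OF ab(1,2), of h, symmetric] h[symmetric] by simp
  moreover have "(b - a) ^ (2 * h + 1) = - ((a - b) ^ (2 * h + 1))"
    using power_minus_odd[of "2 * h + 1" "a - b"] by simp
  then have "2 * b * v = 2 * b * odd_binomial_sum c (c + 1) h"
    unfolding odd_binomial_sum_eq[OF ab(2,1), of h, symmetric] add.commute[of b a]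
    by (simp only: h[symmetric])
  ultimately show ?thesis using ab(3,4) by auto
qed

text \<open>
  Let \<open>m = 2 h + 1\<close>. The term with \<open>i = 0\<close> is \<open>m S\<^sup>h\<close>, with the same number of factors \<open>q\<close> as \<open>m\<close>; every
  other term has strictly more. Indeed \<open>(2i + 1) (m choose 2i + 1)\<close> is a multiple of \<open>m\<close>, and the
  factor \<open>R\<^sup>i\<close> outweighs what \<open>2 i + 1\<close> can absorb, since \<open>5\<^sup>i > 2 i + 1\<close>. Hence the whole sum has
  exactly as many factors \<open>q\<close> as \<open>m\<close>.
\<close>

lemma odd_binomial_sum_dvd:
  fixes q :: nat
  assumes q: "prime q" "5 \<le> q" and R: "int q dvd R" and S: "\<not> int q dvd S"
    and dvd: "int q ^ t dvd odd_binomial_sum R S h"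
  shows "q ^ t dvd 2 * h + 1"
proof (rule ccontr)
  assume not_dvd: "\<not> q ^ t dvd 2 * h + 1"
  define v where "v = multiplicity q (2 * h + 1)"
  have not_unit: "\<not> is_unit q" using q by auto
  have "v < t"
    using not_dvd power_dvd_iff_le_multiplicity[of "2 * h + 1" q t] not_unit by (simp add: v_def)
  have higher: "q ^ (v + 1) dvd ((2 * h + 1) choose (2 * i + 1)) * q ^ i" if i: "i \<in> {1..h}" for i
  proof -
    let ?C = "(2 * h + 1) choose (2 * i + 1)"
    let ?s = "multiplicity q (2 * i + 1)"
    have "?C \<noteq> 0" using i by simp
    \<comment> \<open>A power of \<open>q \<ge> 5\<close> that divides \<open>2 i + 1\<close> is smaller than \<open>5\<^sup>i\<close>.\<close>
    have "?s < i"
    proof (rule ccontr)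
      assume "\<not> ?s < i"
      have "5 ^ i \<le> q ^ i" using q(2) by (intro power_mono) auto
      also have "\<dots> \<le> q ^ ?s"
        using q(2) \<open>\<not> ?s < i\<close> by (intro power_increasing) auto
      also have "\<dots> \<le> 2 * i + 1" by (intro dvd_imp_le multiplicity_dvd) simp
      also have "2 * i + 1 < 5 ^ i"
      proof -
        have "2 * Suc k + 1 < 5 ^ Suc k" for k :: nat by (induction k) auto
        then show ?thesis using i by (cases i) auto
      qed
      finally show False by simp
    qed
    have "v \<le> ?s + multiplicity q ?C"
    proof -
      have "(2 * i + 1) * ?C = (2 * h + 1) * ((2 * h) choose (2 * i))"
        using binomial_absorption[of "2 * i" "2 * h + 1"] by simp
      then have "q ^ v dvd (2 * i + 1) * ?C"
        by (simp only: v_def multiplicity_dvd dvd_mult2)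
      then have "v \<le> multiplicity q ((2 * i + 1) * ?C)"
        using \<open>?C \<noteq> 0\<close> not_unit
        by (subst power_dvd_iff_le_multiplicity[symmetric]) (simp_all only: mult_eq_0_iff, simp_all)
      then show ?thesis
        using q(1) \<open>?C \<noteq> 0\<close>
        by (subst prime_elem_multiplicity_mult_distrib[symmetric]) (simp_all only: prime_imp_prime_elem, simp)
    qed
    then have "v + 1 \<le> multiplicity q ?C + i" using \<open>?s < i\<close> by simp
    then have "q ^ (v + 1) dvd q ^ (multiplicity q ?C + i)" by (rule le_imp_power_dvd)
    also have "\<dots> dvd ?C * q ^ i"
      unfolding power_add by (intro mult_dvd_mono multiplicity_dvd dvd_refl)
    finally show ?thesis .
  qed
  have tail: "int q ^ (v + 1) dvd (\<Sum>i\<in>{1..h}. int ((2 * h + 1) choose (2 * i + 1)) * R ^ i * S ^ (h - i))"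
    (is "_ dvd ?tail")
  proof (rule dvd_sum, rule dvd_mult2)
    fix i assume "i \<in> {1..h}"
    then have "int q ^ (v + 1) dvd int ((2 * h + 1) choose (2 * i + 1)) * int q ^ i"
      using higher[of i] by (metis int_dvd_int_iff of_nat_mult of_nat_power)
    also have "\<dots> dvd int ((2 * h + 1) choose (2 * i + 1)) * R ^ i"
      using R by (intro mult_dvd_mono dvd_power_same dvd_refl)
    finally show "int q ^ (v + 1) dvd int ((2 * h + 1) choose (2 * i + 1)) * R ^ i" .
  qed
  have "odd_binomial_sum R S h = int (2 * h + 1) * S ^ h + ?tail"
    unfolding odd_binomial_sum_def atMost_atLeast0
    by (subst sum.atLeast_Suc_atMost) auto
  moreover have "int q ^ (v + 1) dvd odd_binomial_sum R S h"
    by (rule dvd_trans[OF le_imp_power_dvd dvd]) (use \<open>v < t\<close> in simp)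
  ultimately have "int q ^ (v + 1) dvd int (2 * h + 1) * S ^ h"
    using dvd_add_left_iff[OF tail] by simp
  moreover have "coprime (int q ^ (v + 1)) (S ^ h)"
    using prime_imp_coprime[of "int q" S] q(1) S by simp
  ultimately have "int q ^ (v + 1) dvd int (2 * h + 1)"
    by (simp only: coprime_dvd_mult_left_iff)
  then have "q ^ (v + 1) dvd 2 * h + 1" by (metis int_dvd_int_iff of_nat_power)
  then show False
    using power_dvd_iff_le_multiplicity[of "2 * h + 1" q "v + 1"] not_unit by (simp add: v_def)
qed

text \<open>
  For \<open>h > 0\<close> the sum would exceed its first term's factor \<open>2 h + 1\<close>, which it divides by the previous
  lemma.
\<close>

lemma odd_binomial_sum_prime_power:
  fixes q :: nat
  assumes q: "prime q" "5 \<le> q" and R: "int q dvd R" and S: "\<not> int q dvd S"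
    and "0 \<le> R" "2 \<le> S" and eq: "odd_binomial_sum R S h = int q ^ t"
  shows "t = 0"
proof -
  have "h = 0"
  proof (rule ccontr)
    assume "h \<noteq> 0"
    have "q ^ t dvd 2 * h + 1" using eq by (intro odd_binomial_sum_dvd[OF q R S]) simp
    then have "q ^ t \<le> 2 * h + 1" by (rule dvd_imp_le) simp
    have "int (2 * h + 1) * 1 < int (2 * h + 1) * S ^ h"
      using \<open>h \<noteq> 0\<close> \<open>2 \<le> S\<close> by (intro mult_strict_left_mono one_less_power) auto
    also have "\<dots> \<le> int q ^ t"
    proof -
      have "int ((2 * h + 1) choose (2 * 0 + 1)) * R ^ 0 * S ^ (h - 0) \<le> odd_binomial_sum R S h"
        unfolding odd_binomial_sum_def using assms(5,6) by (intro member_le_sum) auto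
      then show ?thesis by (simp add: eq)
    qed
    finally have "int (2 * h + 1) < int (q ^ t)" by simp
    then show False using \<open>q ^ t \<le> 2 * h + 1\<close> by linarith
  qed
  then have "int q ^ t = 1" using eq by (simp add: odd_binomial_sum_def)
  then show ?thesis using q by (cases t) (auto simp: zmult_eq_1_iff)
qed

lemma pell_consecutive_left_prime_power:
  fixes q :: nat and c v :: int
  assumes q: "prime q" "5 \<le> q" and "int q dvd c + 1" "0 < c" "0 < v"
    and eq: "(c + 1) * (int q ^ t)\<^sup>2 - c * v\<^sup>2 = 1"
  shows "t = 0"
proof -
  obtain h where h: "int q ^ t = odd_binomial_sum (c + 1) c h"
    using pell_consecutive_solutions[of c "int q ^ t" v] assms by auto
  have "int q \<le> c + 1" using assms by (intro zdvd_imp_le) auto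
  moreover have "\<not> int q dvd c"
  proof
    assume "int q dvd c"
    with assms(3) have "int q dvd 1" using dvd_add_right_iff by blast
    then show False using q by simp
  qed
  ultimately show ?thesis
    using assms h by (intro odd_binomial_sum_prime_power[OF q, of "c + 1" c h]) auto
qed

lemma pell_consecutive_right_prime_power:
  fixes q :: nat and c u :: int
  assumes q: "prime q" "5 \<le> q" and "int q dvd c" "0 < c" "0 < u"
    and eq: "(c + 1) * u\<^sup>2 - c * (int q ^ t)\<^sup>2 = 1"
  shows "t = 0"
proof -
  obtain h where h: "int q ^ t = odd_binomial_sum c (c + 1) h"
    using pell_consecutive_solutions[of c u "int q ^ t"] assms by auto
  moreover have "\<not> int q dvd c + 1"
    using assms(3) q by (simp add: dvd_add_right_iff)
  ultimately show ?thesis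
    using assms h by (intro odd_binomial_sum_prime_power[OF q, of c "c + 1" h]) auto
qed

section \<open>Squares among geometric sums\<close>

text \<open>
  The multiplicity in \<open>y\<close> of every prime other than \<open>p\<close> is even, so the parity of the multiplicity of
  \<open>p\<close> decides which alternative holds.
\<close>

lemma square_product_gcd_prime_power:
  fixes x y z p :: nat
  assumes "x * y = z\<^sup>2" "0 < z" "prime p"
    and common: "\<And>s. prime s \<Longrightarrow> s dvd x \<Longrightarrow> s dvd y \<Longrightarrow> s = p"
  shows "is_square y \<or> is_square (p * y)"
proof -
  have pos: "x \<noteq> 0" "y \<noteq> 0" using assms(1,2) by (auto intro!: Nat.gr0I)
  have even_y: "even (multiplicity s y)" if s: "prime s" "s \<noteq> p" for s
  proof (cases "s dvd y")
    case True
    with common[OF s(1)] s(2) have "\<not> s dvd x" by blast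
    then have "multiplicity s x = 0" by (rule not_dvd_imp_multiplicity_0)
    then have "multiplicity s y = multiplicity s (x * y)"
      using s(1) pos by (simp add: prime_elem_multiplicity_mult_distrib)
    also have "\<dots> = 2 * multiplicity s z"
      using s(1) \<open>0 < z\<close> by (simp add: assms(1) prime_elem_multiplicity_power_distrib)
    finally show ?thesis by simp
  next
    case False
    then show ?thesis by (simp add: not_dvd_imp_multiplicity_0)
  qed
  show ?thesis
  proof (cases "even (multiplicity p y)")
    case True
    then have "is_square y"
      using even_y by (auto simp: is_nth_power_conv_multiplicity_nat)
    then show ?thesis ..
  next
    case False
    have "even (multiplicity s (p * y))" if "prime s" for s
    proof (cases "s = p")
      case True
      then show ?thesis
        using False assms(3) pos by (simp add: prime_elem_multiplicity_mult_distrib)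
    next
      case False
      then show ?thesis
        using even_y[OF that] that assms(3) pos
        by (simp add: prime_elem_multiplicity_mult_distrib prime_multiplicity_other)
    qed
    then have "is_square (p * y)" by (simp add: is_nth_power_conv_multiplicity_nat)
    then show ?thesis ..
  qed
qed

text \<open>
  If neither factor is a square, each has a prime of odd multiplicity; both primes must then divide
  \<open>l\<close> and so coincide, against coprimality.
\<close>

lemma coprime_product_times_prime_square:
  fixes a b l w z :: nat
  assumes "a * b * l * w\<^sup>2 = z\<^sup>2" "0 < z" "coprime a b" "l = 1 \<or> prime l"
  shows "is_square a \<or> is_square b"
proof (rule ccontr)
  assume "\<not> (is_square a \<or> is_square b)"
  then obtain s t where s: "prime s" "odd (multiplicity s a)" and t: "prime t" "odd (multiplicity t b)"
    by (auto simp: is_nth_power_conv_multiplicity_nat)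
  have pos: "a \<noteq> 0" "b \<noteq> 0" "l \<noteq> 0" "w \<noteq> 0" using assms(1,2) by (auto intro!: Nat.gr0I)
  have par: "even (multiplicity r a + multiplicity r b + multiplicity r l)" if r: "prime r" for r
  proof -
    have "multiplicity r a + multiplicity r b + multiplicity r l + 2 * multiplicity r w
        = multiplicity r (a * b * l * w\<^sup>2)"
      using pos r by (simp add: prime_elem_multiplicity_mult_distrib prime_elem_multiplicity_power_distrib)
    also have "\<dots> = 2 * multiplicity r z"
      unfolding assms(1) using r \<open>0 < z\<close> by (simp add: prime_elem_multiplicity_power_distrib)
    finally show ?thesis by presburger
  qed
  have odd_imp_dvd: "r dvd x" if "odd (multiplicity r x)" for r x :: nat
    using that by (rule contrapos_pp) (simp add: not_dvd_imp_multiplicity_0)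
  have dvd: "s dvd a" "t dvd b" using s t by (simp_all add: odd_imp_dvd)
  have "\<not> s dvd b" "\<not> t dvd a"
    using dvd assms(3) s(1) t(1) by (meson coprime_common_divisor not_prime_unit)+
  then have "odd (multiplicity s l)" "odd (multiplicity t l)"
    using par[OF s(1)] par[OF t(1)] s t by (auto simp: not_dvd_imp_multiplicity_0)
  then have "s dvd l" "t dvd l" by (simp_all add: odd_imp_dvd)
  then have "s = t" using assms(4) s(1) t(1) by (metis nat_dvd_1_iff_1 not_prime_1 primes_dvd_imp_eq)
  then show False using dvd \<open>\<not> s dvd b\<close> by simp
qed

text \<open>
  For \<open>k = 2 t + 1\<close> a square value \<open>y\<^sup>2\<close> solves \<open>q (q\<^sup>t)\<^sup>2 - (q - 1) y\<^sup>2 = 1\<close>. This is a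
  case of the Nagell-Ljunggren equation, with a prime base at least \<open>5\<close>.
\<close>

lemma repunit_not_square:
  fixes q k y :: nat
  assumes "prime q" "5 \<le> q" "odd k" "1 < k"
  shows "(\<Sum>i<k. q ^ i) \<noteq> y\<^sup>2"
proof
  assume sq: "(\<Sum>i<k. q ^ i) = y\<^sup>2"
  obtain t where t: "k = 2 * t + 1" using \<open>odd k\<close> by (elim oddE)
  have "0 < y"
  proof (rule Nat.gr0I)
    assume "y = 0"
    then have "(\<Sum>i<k. q ^ i) = 0" using sq by simp
    then show False using assms by auto
  qed
  have "int q ^ k - 1 = (int q - 1) * (\<Sum>i<k. int q ^ i)"
    by (rule power_diff_1_eq)
  also have "(\<Sum>i<k. int q ^ i) = (int y)\<^sup>2"
    using sq by (metis (mono_tags, lifting) of_nat_power of_nat_sum sum.cong)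
  finally have "(int q - 1 + 1) * (int q ^ t)\<^sup>2 - (int q - 1) * (int y)\<^sup>2 = 1"
    unfolding t by (simp add: power_mult[symmetric] mult.commute[of t])
  then have "t = 0"
    using assms(1,2) \<open>0 < y\<close> by (intro pell_consecutive_left_prime_power[of q "int q - 1" "int y"]) auto
  then show False using t \<open>1 < k\<close> by simp
qed

text \<open>
  The same argument with the base \<open>-Q\<close>: for \<open>p = 2 t + 1\<close> and \<open>Q = q\<^sup>e\<close>, a square value \<open>y\<^sup>2\<close> solves
  \<open>(Q + 1) y\<^sup>2 - Q (q\<^bsup>et\<^esup>)\<^sup>2 = 1\<close>, now with the prime power in the second place.
\<close>

lemma alt_geom_not_square:
  assumes "prime q" "5 \<le> q" "0 < e" "odd p" "1 < p"
  shows "alt_geom (q ^ e) p \<noteq> (int y)\<^sup>2"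
proof
  assume sq: "alt_geom (q ^ e) p = (int y)\<^sup>2"
  obtain t where t: "p = 2 * t + 1" using \<open>odd p\<close> by (elim oddE)
  have "0 < y" using alt_geom_pos[OF \<open>odd p\<close>, of "q ^ e"] sq by (cases y) auto
  have "(int (q ^ e) + 1) * (int y)\<^sup>2 - int (q ^ e) * (int q ^ (e * t))\<^sup>2 = 1"
  proof -
    have "int (q ^ e) ^ p = int (q ^ e) * (int q ^ (e * t))\<^sup>2"
      by (simp add: t power_mult power_add power2_eq_square mult_2)
    then show ?thesis
      using alt_geom_closed_odd[OF \<open>odd p\<close>, of "q ^ e"] unfolding sq by linarith
  qed
  moreover have "int q dvd int (q ^ e)" using \<open>0 < e\<close> by (simp add: dvd_power)
  ultimately have "e * t = 0"
    using assms(1,2) \<open>0 < y\<close>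
    by (intro pell_consecutive_right_prime_power[of q "int (q ^ e)" "int y"]) (auto simp: prime_gt_0_nat)
  then show False using t \<open>0 < e\<close> \<open>1 < p\<close> by simp
qed

text \<open>
  With a prime \<open>p\<close> dividing \<open>k\<close> and \<open>Q = q\<^bsup>k/p\<^esup>\<close>, the factorisation
  \<open>Q\<^sup>p + 1 = (Q + 1) E\<^sub>p\<close> leaves only the two possibilities that \<open>E\<^sub>p\<close> or \<open>p E\<^sub>p\<close> is a square. The
  congruence \<open>q \<equiv> 1 (mod 4)\<close> matters: \<open>23\<^sup>3 + 1 = 2 \<cdot> 78\<^sup>2\<close>.
\<close>

lemma prime_power_plus_1_not_double_square:
  fixes q k y :: nat
  assumes q: "prime q" "[q = 1] (mod 4)" and k: "odd k" "1 < k"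
  shows "q ^ k + 1 \<noteq> 2 * y\<^sup>2"
proof
  assume eq: "q ^ k + 1 = 2 * y\<^sup>2"
  have q5: "5 \<le> q"
  proof -
    have "q mod 4 = 1" using q(2) by (simp add: cong_def)
    moreover have "q \<noteq> 1" using q(1) by auto
    ultimately show ?thesis by presburger
  qed
  obtain p where p: "prime p" "p dvd k" using k(2) by (metis less_irrefl prime_factor_nat)
  then obtain e where e: "k = e * p" by (metis dvd_div_mult_self)
  have "odd p" "0 < e" using k e by (auto intro: Nat.gr0I)
  then have "2 < p" using prime_ge_2_nat[OF p(1)] by (cases "p = 2") auto
  define Q where "Q = q ^ e"
  have Q4: "[Q = 1] (mod 4)" using cong_pow[OF q(2), of e] by (simp add: Q_def)
  define E where "E = nat (alt_geom Q p)"
  have E: "int E = alt_geom Q p" using alt_geom_pos[OF \<open>odd p\<close>, of Q] by (simp add: E_def)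
  have "Q + 1 = 2 * ((Q + 1) div 2)" using odd_if_cong_1_mod_4[OF Q4] by simp
  then obtain M where M: "Q + 1 = 2 * M" by blast
  have "int ((Q + 1) * E) = int (Q ^ p + 1)"
    using alt_geom_closed_odd[OF \<open>odd p\<close>, of Q]
    by (simp only: of_nat_mult of_nat_add of_nat_1 of_nat_power E)
  then have "(Q + 1) * E = Q ^ p + 1" by (simp only: of_nat_eq_iff)
  also have "\<dots> = 2 * y\<^sup>2" using eq by (simp add: Q_def e power_mult)
  finally have ME: "M * E = y\<^sup>2" unfolding M by simp
  have "0 < y" using eq by (cases y) auto
  have common: "s = p" if s: "prime s" "s dvd M" "s dvd E" for s
  proof -
    have "int s dvd int Q + 1" using s(2) M by (metis dvd_mult int_dvd_int_iff of_nat_1 of_nat_add)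
    then have "[- int Q = 1] (mod int s)"
      by (metis cong_iff_dvd_diff cong_sym diff_minus_eq_add add.commute)
    then have "[alt_geom Q p = (\<Sum>i<p. 1 ^ i)] (mod int s)"
      unfolding alt_geom_def by (intro cong_sum cong_pow)
    then have "[int E = int p] (mod int s)" by (simp add: E)
    then have "s dvd p" using s(3) by (metis cong_dvd_iff cong_int_iff)
    then show "s = p" using s(1) p(1) by (simp add: primes_dvd_imp_eq)
  qed
  from square_product_gcd_prime_power[OF ME \<open>0 < y\<close> p(1) common]
  show False
  proof
    assume "is_square E"
    then obtain r where "E = r\<^sup>2" by (elim is_nth_powerE)
    then have "alt_geom Q p = (int r)\<^sup>2" using E by simp
    then show False
      using alt_geom_not_square[OF q(1) q5 \<open>0 < e\<close> \<open>odd p\<close>] \<open>2 < p\<close> by (simp add: Q_def)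
  next
    assume "is_square (p * E)"
    then obtain r where "p * E = r\<^sup>2" by (elim is_nth_powerE)
    then have "int p * alt_geom Q p = (int r)\<^sup>2" using E by (metis of_nat_mult of_nat_power)
    then show False using prime_times_alt_geom_not_square[OF Q4 p(1) \<open>2 < p\<close>] by blast
  qed
qed

section \<open>The divisor sum\<close>

lemma finite_positive_divisors: "0 < m \<Longrightarrow> finite {d::int. 0 < d \<and> d dvd m}"
  by (rule finite_subset[of _ "{0..m}"]) (auto intro: zdvd_imp_le)

lemma divisor_sum_ge:
  assumes "0 < m"
  shows "m \<le> divisor_sum m"
  unfolding divisor_sum_def
  using finite_positive_divisors[OF assms] assms by (intro member_le_sum) auto

text \<open>
  The two factors of a divisor of \<open>m n\<close> are recovered as its greatest common divisors with \<open>m\<close> and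
  \<open>n\<close>; this makes the product map on pairs of divisors a bijection.
\<close>

lemma gcd_mult_coprime_divisors:
  fixes a b m n :: int
  assumes "coprime m n" "a dvd m" "b dvd n"
  shows "gcd (a * b) m = \<bar>a\<bar>" "gcd (a * b) n = \<bar>b\<bar>"
proof -
  \<comment> \<open>Each factor is coprime to the other modulus, so it does not contribute to that gcd.\<close>
  have "coprime b m" "coprime a n"
    using assms by (meson coprime_commute coprime_divisors dvd_refl)+
  then have "gcd m (a * b) = gcd m a" "gcd n (a * b) = gcd n b"
    by (simp_all add: gcd_mult_right_right_cancel gcd_mult_right_left_cancel coprime_commute)
  then show "gcd (a * b) m = \<bar>a\<bar>" "gcd (a * b) n = \<bar>b\<bar>"
    using assms by (simp_all add: gcd.commute)
qed

lemma divisor_sum_mult_coprime: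
  assumes "coprime m n" "0 < m" "0 < n"
  shows "divisor_sum (m * n) = divisor_sum m * divisor_sum n"
proof -
  let ?D = "\<lambda>m. {d::int. 0 < d \<and> d dvd m}"
  have "divisor_sum m * divisor_sum n = (\<Sum>(a, b)\<in>?D m \<times> ?D n. a * b)"
    unfolding divisor_sum_def by (simp add: sum_product sum.cartesian_product)
  also have "\<dots> = (\<Sum>d\<in>?D (m * n). d)"
  proof (rule sum.reindex_bij_witness[where i = "\<lambda>d. (gcd d m, gcd d n)" and j = "\<lambda>(a, b). a * b"])
    fix d assume d: "d \<in> ?D (m * n)"
    show "(gcd d m, gcd d n) \<in> ?D m \<times> ?D n" using assms by auto
    obtain a b where ab: "d = a * b" "a dvd m" "b dvd n" using d division_decomp by blast
    then have "gcd d m * gcd d n = d"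
      using d gcd_mult_coprime_divisors[OF assms(1) ab(2,3)] by (simp add: abs_mult[symmetric])
    then show "(case (gcd d m, gcd d n) of (a, b) \<Rightarrow> a * b) = d" by simp
  next
    fix ab assume "ab \<in> ?D m \<times> ?D n"
    then obtain a b where ab: "ab = (a, b)" "0 < a" "a dvd m" "0 < b" "b dvd n" by auto
    then show "(case ab of (a, b) \<Rightarrow> a * b) \<in> ?D (m * n)" by (simp add: mult_dvd_mono)
    show "(gcd (case ab of (a, b) \<Rightarrow> a * b) m, gcd (case ab of (a, b) \<Rightarrow> a * b) n) = ab"
      using gcd_mult_coprime_divisors[OF assms(1) ab(3,5)] ab by simp
  qed auto
  finally show ?thesis by (simp add: divisor_sum_def)
qed

lemma divisor_sum_prime_power:
  fixes p :: int
  assumes "prime p"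
  shows "divisor_sum (p ^ a) = (\<Sum>i<Suc a. p ^ i)"
proof -
  have "{d. 0 < d \<and> d dvd p ^ a} = (\<lambda>i. p ^ i) ` {..<Suc a}"
  proof safe
    fix d assume d: "0 < d" "d dvd p ^ a"
    obtain i where "i \<le> a" "normalize d = p ^ i"
      using divides_primepow[OF assms d(2)] by blast
    then show "d \<in> (\<lambda>i. p ^ i) ` {..<Suc a}"
      using d assms prime_gt_0_int[OF assms] by auto
  qed (auto simp: prime_gt_0_int[OF assms] le_imp_power_dvd)
  moreover have "inj_on (\<lambda>i. p ^ i) {..<Suc a}"
    using prime_gt_1_int[OF assms] by (auto intro!: inj_onI)
  ultimately show ?thesis by (simp only: divisor_sum_def sum.reindex) simp
qed

text \<open>
  As \<open>\<sigma>\<close> is multiplicative and exceeds \<open>1\<close> except at \<open>1\<close>, a prime value forces \<open>m = r\<^sup>e\<close>. Then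
  \<open>(r - 1) (2 r\<^sup>e - 1) = r\<^bsup>e+1\<^esup> - 1\<close> rearranges to \<open>(r - 2) (r\<^sup>e - 1) = 0\<close>.
\<close>

lemma even_if_prime_divisor_sum_eq_double_minus_1:
  fixes m q :: int
  assumes "prime q" "divisor_sum m = q" "q = 2 * m - 1" "1 < m"
  shows "even m"
proof -
  obtain r where r: "prime r" "r dvd m"
    using \<open>1 < m\<close> prime_factor_int[of m] by auto
  define e where "e = multiplicity r m"
  obtain s where s: "m = r ^ e * s" "\<not> r dvd s"
    using multiplicity_decompose'[of m r] prime_gt_1_int[OF r(1)] \<open>1 < m\<close>
    unfolding e_def by auto
  have "0 < e" using r s by (cases e) auto
  have "1 < r" using prime_gt_1_int[OF r(1)] .
  then have "0 < r ^ e" by simp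
  then have "0 < s" using s(1) \<open>1 < m\<close> by (metis less_trans zero_less_mult_pos zero_less_one)
  have "coprime (r ^ e) s" using r(1) s(2) by (simp add: prime_imp_coprime)
  then have prod: "divisor_sum (r ^ e) * divisor_sum s = q"
    using assms(2) divisor_sum_mult_coprime[OF _ \<open>0 < r ^ e\<close> \<open>0 < s\<close>] s(1) by simp
  have "1 < r ^ e" using \<open>1 < r\<close> \<open>0 < e\<close> by simp
  then have "1 < divisor_sum (r ^ e)" using divisor_sum_ge[of "r ^ e"] by simp
  have "divisor_sum s = 1"
  proof -
    have "1 \<le> divisor_sum s" using divisor_sum_ge[OF \<open>0 < s\<close>] \<open>0 < s\<close> by simp
    moreover have "is_unit (divisor_sum (r ^ e)) \<or> is_unit (divisor_sum s)"
      using \<open>prime q\<close> prod by (metis irreducible_multD prime_elem_imp_irreducible prime_imp_prime_elem)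
    ultimately show ?thesis using \<open>1 < divisor_sum (r ^ e)\<close> by auto
  qed
  then have "s = 1" using divisor_sum_ge[OF \<open>0 < s\<close>] \<open>0 < s\<close> by simp
  have "(r - 1) * (2 * r ^ e - 1) = r ^ Suc e - 1"
  proof -
    have "2 * r ^ e - 1 = (\<Sum>i<Suc e. r ^ i)"
      using prod \<open>divisor_sum s = 1\<close> divisor_sum_prime_power[OF r(1), of e] assms(3) s(1) \<open>s = 1\<close>
      by simp
    then show ?thesis by (simp only: power_diff_1_eq[symmetric])
  qed
  then have "(r - 2) * (r ^ e - 1) = 0" by (simp add: algebra_simps)
  then have "r = 2" using \<open>1 < r ^ e\<close> by simp
  then show ?thesis using r(2) by simp
qed

lemma perfect_euler_form:
  fixes n q :: int
  assumes "perfect (n\<^sup>2 * q ^ a)" "prime q" "\<not> q dvd n"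
  shows "divisor_sum (n\<^sup>2) * (\<Sum>i<Suc a. q ^ i) = 2 * n\<^sup>2 * q ^ a"
proof -
  have "0 < q ^ a" using prime_gt_0_int[OF assms(2)] by simp
  moreover have "0 < n\<^sup>2" using assms(3) by (cases "n = 0") auto
  moreover have "coprime (n\<^sup>2) (q ^ a)"
    using prime_imp_coprime[OF assms(2,3)] by (simp add: coprime_commute)
  ultimately show ?thesis
    using assms(1) divisor_sum_mult_coprime[of "n\<^sup>2" "q ^ a"] divisor_sum_prime_power[OF assms(2), of a]
    by (simp add: perfect_def)
qed

section \<open>Odd perfect numbers\<close>

text \<open>
  Here \<open>\<sigma>(q\<^sup>a) = 2 A B\<close> with \<open>A = (q\<^sup>k - 1) / (q - 1)\<close>, \<open>B = (q\<^sup>k + 1) / 2\<close> and \<open>a + 1 = 2 k\<close>, and the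
  perfectness equation becomes \<open>A B l w\<^sup>2 = n\<^sup>2\<close>.
\<close>

lemma divisor_sum_quotient_not_near_square:
  fixes n q l w :: int
  assumes perf: "perfect (n\<^sup>2 * q ^ a)" and q: "prime q" "[q = 1] (mod 4)" and "\<not> q dvd n"
    and a: "[a = 1] (mod 4)" "1 < a" and l: "l = 1 \<or> prime l"
  shows "divisor_sum (n\<^sup>2) \<noteq> q ^ a * (l * w\<^sup>2)"
proof
  assume eq: "divisor_sum (n\<^sup>2) = q ^ a * (l * w\<^sup>2)"
  define Q where "Q = nat q"
  have Q: "prime Q" "int Q = q" using q(1) prime_gt_0_int[OF q(1)] by (simp_all add: Q_def)
  have Q4: "[Q = 1] (mod 4)" using q(2) Q(2) cong_int_iff[of Q 1 4] by simp
  have "5 \<le> Q"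
  proof -
    have "Q mod 4 = 1" using Q4 by (simp add: cong_def)
    moreover have "Q \<noteq> 1" using Q(1) by auto
    ultimately show ?thesis by presburger
  qed
  have "\<exists>k. Suc a = 2 * k \<and> odd k \<and> 1 < k"
  proof (intro exI[of _ "Suc a div 2"])
    have "a mod 4 = 1" using a(1) by (simp add: cong_def)
    then show "Suc a = 2 * (Suc a div 2) \<and> odd (Suc a div 2) \<and> 1 < Suc a div 2"
      using a(2) by presburger
  qed
  then obtain k where k: "Suc a = 2 * k" "odd k" "1 < k" by blast
  define A where "A = (\<Sum>i<k. Q ^ i)"
  have "odd (Q ^ k)" using odd_if_cong_1_mod_4[OF Q4] by simp
  then obtain B where B: "Q ^ k + 1 = 2 * B" by (metis evenE odd_one even_add)
  have A_closed: "(q - 1) * int A = q ^ k - 1"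
    unfolding A_def power_diff_1_eq by (simp add: Q(2))
  have G: "(\<Sum>i<Suc a. q ^ i) = int A * (2 * int B)"
  proof -
    \<comment> \<open>This is \<open>(q\<^bsup>2k\<^esup> - 1) / (q - 1)\<close> with the numerator factored as a difference of squares.\<close>
    have "(q - 1) * (\<Sum>i<Suc a. q ^ i) = q ^ (2 * k) - 1"
      unfolding k(1) by (simp only: power_diff_1_eq)
    also have "\<dots> = (q ^ k - 1) * (q ^ k + 1)"
      unfolding mult_2 power_add by (simp add: algebra_simps)
    also have "q ^ k + 1 = 2 * int B" using B Q(2) by (metis of_nat_1 of_nat_add of_nat_mult of_nat_numeral of_nat_power)
    also have "(q ^ k - 1) * (2 * int B) = (q - 1) * (int A * (2 * int B))"
      using A_closed by (simp add: mult.assoc)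
    finally show ?thesis using \<open>5 \<le> Q\<close> Q(2) by simp
  qed
  have "q ^ a * (int A * int B * l * w\<^sup>2) = q ^ a * n\<^sup>2"
    using perfect_euler_form[OF perf q(1) \<open>\<not> q dvd n\<close>] unfolding eq G by (simp add: mult_ac)
  then have "int A * int B * l * w\<^sup>2 = n\<^sup>2"
    using prime_gt_0_int[OF q(1)] by simp
  moreover have "l = int (nat l)" using l prime_ge_0_int by auto
  ultimately have "int A * int B * int (nat l) * \<bar>w\<bar>\<^sup>2 = \<bar>n\<bar>\<^sup>2" by simp
  then have "int (A * B * nat l * (nat \<bar>w\<bar>)\<^sup>2) = int ((nat \<bar>n\<bar>)\<^sup>2)" by simp
  then have eq_nat: "A * B * nat l * (nat \<bar>w\<bar>)\<^sup>2 = (nat \<bar>n\<bar>)\<^sup>2" by (simp only: of_nat_eq_iff)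
  have "coprime A B"
  proof (rule ccontr)
    assume "\<not> coprime A B"
    then have "gcd A B \<noteq> 1" using coprime_iff_gcd_eq_1 by blast
    then obtain s where "prime s" "s dvd gcd A B" using prime_factor_nat by blast
    then have s: "prime s" "s dvd A" "s dvd B" by simp_all
    have "int s dvd q ^ k - 1" using s(2) A_closed by (metis dvd_mult int_dvd_int_iff)
    moreover have "int s dvd q ^ k + 1"
      using s(3) B Q(2) by (metis dvd_mult int_dvd_int_iff of_nat_1 of_nat_add of_nat_power)
    ultimately have "int s dvd (q ^ k + 1) - (q ^ k - 1)" by (rule dvd_diff[rotated])
    then have "int s dvd int 2" by simp
    then have "s dvd 2" by (simp only: int_dvd_int_iff)
    then have "s = 2" using s(1) by (simp add: primes_dvd_imp_eq)
    \<comment> \<open>\<open>A\<close> is a sum of \<open>k\<close> odd numbers, and \<open>k\<close> is odd.\<close>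
    moreover have "odd A"
      using odd_if_cong_1_mod_4[OF Q4] \<open>odd k\<close> by (simp add: A_def even_sum_iff)
    ultimately show False using s(2) by simp
  qed
  moreover have "0 < nat \<bar>n\<bar>" using \<open>\<not> q dvd n\<close> by auto
  moreover have "nat l = 1 \<or> prime (nat l)" using l by auto
  ultimately have "is_square A \<or> is_square B"
    using coprime_product_times_prime_square[OF eq_nat] by blast
  then show False
  proof
    assume "is_square A"
    then obtain y where "A = y\<^sup>2" by (elim is_nth_powerE)
    then show False
      using repunit_not_square[OF Q(1) \<open>5 \<le> Q\<close> k(2,3)] by (simp add: A_def)
  next
    assume "is_square B"
    then obtain y where "B = y\<^sup>2" by (elim is_nth_powerE)
    then show False
      using prime_power_plus_1_not_double_square[OF Q(1) Q4 k(2,3)] B by simp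
  qed
qed

theorem theorem1p1:
  fixes N n \<alpha> q :: int
  assumes "perfect N"
    and "odd N"
    and "prime q"
    and "(of_int N :: rat) = of_int n ^ 2 * of_int q powi \<alpha>"
    and "\<not> q dvd n"
    and "[q = \<alpha>] (mod 4)"
    and "[\<alpha> = 1] (mod 4)"
  shows "(\<alpha> = 1 \<longrightarrow> (of_int (divisor_sum (n ^ 2)) :: rat) / of_int q > 1)
       \<and> (\<alpha> > 1 \<longrightarrow>
            \<not> (\<exists>n\<^sub>0 l :: int. (l = 1 \<or> prime l) \<and>
                 (of_int (divisor_sum (n ^ 2)) :: rat) / of_int q powi \<alpha> = of_int (l * n\<^sub>0 ^ 2)))"
proof -
  have q0: "0 < q" using prime_gt_0_int[OF assms(3)] .
  have powi: "(of_int q :: rat) powi \<alpha> = of_int (q ^ nat \<alpha>)" if "0 \<le> \<alpha>"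
    using that by (simp add: power_int_def)
  have N: "N = n\<^sup>2 * q ^ nat \<alpha>" if "0 \<le> \<alpha>"
  proof -
    have "(of_int N :: rat) = of_int (n\<^sup>2 * q ^ nat \<alpha>)"
      using assms(4) powi[OF that] by simp
    then show ?thesis by (simp only: of_int_eq_iff)
  qed
  show ?thesis
  proof (intro conjI impI notI)
    assume \<alpha>: "\<alpha> = 1"
    have form: "divisor_sum (n\<^sup>2) * (q + 1) = 2 * n\<^sup>2 * q"
      using perfect_euler_form[of n q 1] assms(1,3,5) N \<alpha> by (simp add: add.commute)
    have "0 < n\<^sup>2" using assms(5) by (cases "n = 0") auto
    have "coprime q (q + 1)" by simp
    moreover have "q dvd divisor_sum (n\<^sup>2) * (q + 1)" unfolding form by simp
    ultimately have "q dvd divisor_sum (n\<^sup>2)" by (simp only: coprime_dvd_mult_left_iff)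
    then obtain m where m: "divisor_sum (n\<^sup>2) = q * m" by blast
    have "1 < m"
    proof (rule ccontr)
      assume "\<not> 1 < m"
      moreover have "0 < q * m" using divisor_sum_ge[OF \<open>0 < n\<^sup>2\<close>] \<open>0 < n\<^sup>2\<close> m by linarith
      then have "0 < m" using q0 by (simp add: zero_less_mult_iff)
      ultimately have "m = 1" by simp
      then have "q = 2 * n\<^sup>2 - 1" using form m q0 by (simp add: mult.commute)
      moreover have "1 < n\<^sup>2" using \<open>q = 2 * n\<^sup>2 - 1\<close> prime_gt_1_int[OF assms(3)] by simp
      ultimately have "even (n\<^sup>2)"
        using even_if_prime_divisor_sum_eq_double_minus_1[OF assms(3), of "n\<^sup>2"] m \<open>m = 1\<close> by simp
      moreover have "N = n\<^sup>2 * q" using N \<alpha> by simp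
      ultimately show False using assms(2) by simp
    qed
    then show "(of_int (divisor_sum (n ^ 2)) :: rat) / of_int q > 1"
      using q0 by (simp add: m)
  next
    assume \<alpha>: "1 < \<alpha>"
    assume "\<exists>n\<^sub>0 l :: int. (l = 1 \<or> prime l) \<and>
      (of_int (divisor_sum (n ^ 2)) :: rat) / of_int q powi \<alpha> = of_int (l * n\<^sub>0 ^ 2)"
    then obtain w l :: int where l: "l = 1 \<or> prime l"
      and quot: "(of_int (divisor_sum (n ^ 2)) :: rat) / of_int q powi \<alpha> = of_int (l * w ^ 2)"
      by blast
    have "(of_int (divisor_sum (n\<^sup>2)) :: rat) = of_int (q ^ nat \<alpha> * (l * w\<^sup>2))"
      using quot powi \<alpha> q0 by (simp add: field_simps)
    then have "divisor_sum (n\<^sup>2) = q ^ nat \<alpha> * (l * w\<^sup>2)" by (simp only: of_int_eq_iff)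
    moreover have "[nat \<alpha> = 1] (mod 4)"
      using assms(7) \<alpha> cong_int_iff[of "nat \<alpha>" 1 4] by simp
    moreover have "[q = 1] (mod 4)" using assms(6,7) by (rule cong_trans)
    ultimately show False
      using divisor_sum_quotient_not_near_square[of n q "nat \<alpha>" l w] assms(1,3,5) N \<alpha> l by simp
  qed
qed

end
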